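(* Let $q(n)=an^2+bn+c$ be a quadratic polynomial with integer coefficients and positive leading coefficient $a$. For each prime $p$ let $m_q(p)=\sup\{k\in\mathbb{N}\cup\{0\}: q(n)\equiv 0 \pmod{p^k}\text{ has an integer solution } n\}$ (possibly $\infty$). Let $p_n$ denote the $n$-th prime, and let $r$ be the least positive integer such that $m_q(p_r)=\infty$ (such $r$ exists). Then there are infinitely many practical numbers of the form $q(n)$ with $n\in\mathbb{N}$ if and only if $p_1^{m_q(p_1)}p_2^{m_q(p_2)}\cdots p_{r-1}^{m_q(p_{r-1})}\,p_r$ is a practical number.
   Context: A positive integer $N$ is called a practical number if every integer in $[1,N]$ can be expressed as a sum of distinct positive divisors of $N$. *)

theory Defs
  imports "HOL-Computational_Algebra.Primes" "HOL-Library.Extended_Nat" "HOL-Library.Infinite_Set"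
begin

definition practical :: "nat \<Rightarrow> bool" where
  "practical N \<longleftrightarrow> N > 0 \<and>
     (\<forall>m \<in> {1..N}. \<exists>S. S \<subseteq> {d. d dvd N} \<and> \<Sum>S = m)"

text \<open>The n-th prime, 1-indexed: nthprime 1 = 2, nthprime 2 = 3, ...\<close>
definition nthprime :: "nat \<Rightarrow> nat" where
  "nthprime n = enumerate {p::nat. prime p} (n - 1)"

definition mq :: "int \<Rightarrow> int \<Rightarrow> int \<Rightarrow> nat \<Rightarrow> enat" where
  "mq a b c p = Sup {enat k | k. \<exists>n::int. (int p) ^ k dvd a * n^2 + b * n + c}"

end

theory Submission
  imports Defs "HOL-Number_Theory.Cong" "HOL-Analysis.Harmonic_Numbers"
begin

text \<open>
  Let $Q$ be the number in the theorem. If $N = q(n) \ge p_r$ is practical and $p \le p_r$ is prime, then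
  $p - 1$ is a sum of divisors of $N$ all of whose prime factors lie below $p$; these divide $Q$, and
  Stewart's criterion for $Q$ follows.

  Conversely let $Q$ be practical. Take $M = Q p_r^k B$ with $k$ large and choose $n \in [M, 2M)$ with
  $M \mid q(n)$. The cofactor $q(n)/M$ is at most $KM$ with $K$ depending only on $q$, so $q(n)$ is
  practical as soon as $\sigma(B) \ge K B$. To find such a $B$, composed of primes $p$ with
  $m_q(p) = \infty$, let $D$ be the discriminant of $q$ and multiply the primitive values of
  $X^2 - DY^2$ with $2aD \mid Y$ in a cone $0 < cY \le X$: the sum of their reciprocals diverges with the
  harmonic series, and it is bounded by $(\sigma(B)/B)^2$. For $D = 0$ the numbers $1 + 2aj$ serve instead.
\<close>

subsection \<open>Stewart's criterion for practical numbers\<close>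

definition sigma :: "nat \<Rightarrow> nat" where
  "sigma N = \<Sum>{d. d dvd N}"

definition smooth_divisors :: "nat \<Rightarrow> nat \<Rightarrow> nat set" where
  "smooth_divisors N p = {d. d dvd N \<and> (\<forall>q. prime q \<longrightarrow> q dvd d \<longrightarrow> q < p)}"

text \<open>Stewart's criterion, stated with $\sigma$ of the part of $N$ composed of primes below $p$.\<close>
definition stewart :: "nat \<Rightarrow> bool" where
  "stewart N \<longleftrightarrow> N > 0 \<and>
     (\<forall>p. prime p \<longrightarrow> p dvd N \<longrightarrow> p \<le> 1 + \<Sum>(smooth_divisors N p))"

text \<open>Reaching \<open>sigma N\<close> instead of \<open>N\<close> is the stronger form of
  practicality that survives induction over prime powers.\<close>

definition subset_sum_complete :: "nat \<Rightarrow> bool" where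
  "subset_sum_complete N \<longleftrightarrow> (\<forall>m \<le> sigma N. \<exists>S. S \<subseteq> {d. d dvd N} \<and> \<Sum>S = m)"

lemma smooth_divisors_subset: "smooth_divisors N p \<subseteq> {d. d dvd N}"
  by (auto simp: smooth_divisors_def)

lemma finite_smooth_divisors: "N > 0 \<Longrightarrow> finite (smooth_divisors N p)"
  by (rule finite_subset[OF smooth_divisors_subset]) auto

lemma sum_nat_mono_subset:
  fixes A B :: "nat set"
  assumes "finite B" "A \<subseteq> B"
  shows "\<Sum>A \<le> \<Sum>B"
  using assms by (intro sum_mono2) auto

lemma sum_smooth_divisors_le_sigma:
  assumes "N > 0"
  shows "\<Sum>(smooth_divisors N p) \<le> sigma N"
  unfolding sigma_def using assms
  by (intro sum_nat_mono_subset smooth_divisors_subset) auto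

lemma le_sigma:
  assumes "N > 0"
  shows "N \<le> sigma N"
  using sum_nat_mono_subset[of "{d. d dvd N}" "{N}"] assms by (simp add: sigma_def)

text \<open>A divisor prime to \<open>p\<close> already divides \<open>N\<close>; from any other one
  a factor \<open>p\<close> can be cancelled.\<close>

lemma divisors_mult_prime_power_Suc:
  fixes N p :: nat
  assumes "prime p" "\<not> p dvd N"
  shows "{d. d dvd N * p ^ Suc k} = {d. d dvd N} \<union> (*) p ` {d. d dvd N * p ^ k}"
proof (intro equalityI subsetI)
  fix d assume "d \<in> {d. d dvd N * p ^ Suc k}"
  then have d: "d dvd N * p ^ Suc k" by simp
  show "d \<in> {d. d dvd N} \<union> (*) p ` {d. d dvd N * p ^ k}"
  proof (cases "p dvd d")
    case True
    then obtain e where e: "d = p * e" by blast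
    have "p * e dvd p * (N * p ^ k)" using d e by (simp add: ac_simps)
    then have "e dvd N * p ^ k" using assms(1) by (simp add: prime_gt_0_nat)
    then show ?thesis using e by blast
  next
    case False
    then have "coprime d (p ^ Suc k)"
      using assms(1) by (metis coprime_commute coprime_power_right_iff prime_imp_coprime)
    then show ?thesis using d by (simp add: coprime_dvd_mult_left_iff)
  qed
next
  fix d assume "d \<in> {d. d dvd N} \<union> (*) p ` {d. d dvd N * p ^ k}"
  then show "d \<in> {d. d dvd N * p ^ Suc k}"
    by (auto simp: mult.left_commute intro: dvd_mult2 mult_dvd_mono)
qed

text \<open>The divisors split into those of \<open>N\<close> and \<open>p\<close> times those of
  \<open>N * p ^ k\<close>, so it suffices to write a target as \<open>r + p * m'\<close> with
  \<open>r\<close> and \<open>m'\<close> each within reach of its own block.\<close>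

lemma subset_sum_complete_mult_prime_power:
  assumes N: "N > 0" and p: "prime p" "\<not> p dvd N" "p \<le> 1 + sigma N"
    and comp: "subset_sum_complete N"
  shows "subset_sum_complete (N * p ^ k)"
proof (induction k)
  case 0
  then show ?case using comp by simp
next
  case (Suc k)
  let ?D = "{d. d dvd N}" and ?E = "{d. d dvd N * p ^ k}"
  have p0: "p > 0" using p(1) by (rule prime_gt_0_nat)
  have fin: "finite ?D" "finite ?E" using N p0 by auto
  have inj: "inj_on ((*) p) S" for S using p0 by (auto simp: inj_on_def)
  have disj: "S \<inter> (*) p ` T = {}" if "S \<subseteq> ?D" for S T
    using that p(2) by (auto intro: dvd_trans dvd_triv_left)
  have union_sum: "\<Sum>(S \<union> (*) p ` T) = \<Sum>S + p * \<Sum>T" if "S \<subseteq> ?D" "T \<subseteq> ?E" for S T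
  proof -
    have "finite S" "finite T" using that fin finite_subset by blast+
    then have "\<Sum>(S \<union> (*) p ` T) = \<Sum>S + \<Sum>((*) p ` T)"
      using disj[OF that(1)] by (intro sum.union_disjoint) auto
    also have "\<Sum>((*) p ` T) = p * \<Sum>T"
      by (simp add: sum.reindex[OF inj] sum_distrib_left)
    finally show ?thesis .
  qed
  note divs = divisors_mult_prime_power_Suc[OF p(1,2), of k]
  have sig: "sigma (N * p ^ Suc k) = sigma N + p * sigma (N * p ^ k)"
    using union_sum[of ?D ?E] divs by (simp add: sigma_def del: power_Suc)
  show ?case unfolding subset_sum_complete_def
  proof (intro allI impI)
    fix m assume m: "m \<le> sigma (N * p ^ Suc k)"
    \<comment> \<open>Below \<open>p * sigma (N * p ^ k)\<close> division with remainder works,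
      since the remainder is at most \<open>p - 1 \<le> sigma N\<close>. Above it, \<open>m'\<close>
      is taken maximal and the rest fits into \<open>sigma N\<close>.\<close>
    have "\<exists>r m'. m = r + p * m' \<and> r \<le> sigma N \<and> m' \<le> sigma (N * p ^ k)"
    proof (cases "m \<le> p * sigma (N * p ^ k)")
      case True
      have "m div p \<le> sigma (N * p ^ k)"
        using div_le_mono[OF True, of p] p0 by simp
      moreover have "m mod p \<le> sigma N" using p(3) mod_less_divisor[OF p0, of m] by linarith
      ultimately show ?thesis by (intro exI[of _ "m mod p"] exI[of _ "m div p"]) simp
    next
      case False
      then show ?thesis using m sig
        by (intro exI[of _ "m - p * sigma (N * p ^ k)"] exI[of _ "sigma (N * p ^ k)"]) auto
    qed
    then obtain r m' where rm: "m = r + p * m'" "r \<le> sigma N" "m' \<le> sigma (N * p ^ k)" by blast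
    obtain S where S: "S \<subseteq> ?D" "\<Sum>S = r" using comp rm(2) unfolding subset_sum_complete_def by blast
    obtain T where T: "T \<subseteq> ?E" "\<Sum>T = m'" using Suc rm(3) unfolding subset_sum_complete_def by blast
    show "\<exists>U. U \<subseteq> {d. d dvd N * p ^ Suc k} \<and> \<Sum>U = m"
      unfolding divs using union_sum[OF S(1) T(1)] S T rm(1)
      by (intro exI[of _ "S \<union> (*) p ` T"]) blast
  qed
qed

text \<open>Induction by removing the full power of the largest prime \<open>p\<close>: Stewart's
  condition passes to the cofactor \<open>N'\<close>, and at \<open>p\<close> itself it yields
  \<open>p \<le> 1 + sigma N'\<close>.\<close>

lemma stewart_imp_subset_sum_complete:
  "stewart N \<Longrightarrow> subset_sum_complete N"
proof (induction N rule: less_induct)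
  case (less N)
  have N: "N > 0" using less.prems by (simp add: stewart_def)
  show ?case
  proof (cases "N = 1")
    case True
    have "\<exists>S. S \<subseteq> {d::nat. d dvd 1} \<and> \<Sum>S = m" if "m \<le> 1" for m :: nat
    proof (cases "m = 0")
      case True
      then show ?thesis by (intro exI[of _ "{}"]) auto
    next
      case False
      then show ?thesis using that by (intro exI[of _ "{1}"]) auto
    qed
    then show ?thesis using True by (simp add: subset_sum_complete_def sigma_def)
  next
    case False
    define p where "p = Max (prime_factors N)"
    have "prime_factors N \<noteq> {}" using False N prime_factor_nat[of N] by (auto simp: prime_factors_dvd)
    then have "p \<in> prime_factors N" unfolding p_def by (intro Max_in) auto
    then have p: "prime p" "p dvd N" by auto
    have p_max: "q \<le> p" if "prime q" "q dvd N" for q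
      unfolding p_def using that N by (intro Max_ge) (auto simp: prime_factors_dvd)
    obtain N' where N': "N = p ^ multiplicity p N * N'" "\<not> p dvd N'"
      using multiplicity_decompose'[of N p] N p(1) by (metis less_not_refl not_prime_unit)
    define k where "k = multiplicity p N"
    have N_eq: "N = N' * p ^ k" using N'(1) by (simp add: k_def mult.commute)
    have N'0: "N' > 0" using N N_eq by (cases N') auto
    have "N' \<noteq> N" using p(2) N'(2) by blast
    then have less_N: "N' < N" using N N_eq by (metis dvd_imp_le dvd_triv_left le_neq_implies_less)
    \<comment> \<open>A divisor with all primes below \<open>q \<le> p\<close> is prime to
      \<open>p\<close>, so it survives in \<open>N'\<close>.\<close>
    have smooth: "smooth_divisors N q \<subseteq> smooth_divisors N' q" if "q \<le> p" for q
    proof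
      fix d assume d: "d \<in> smooth_divisors N q"
      then have "\<not> p dvd d" using that p(1) leD unfolding smooth_divisors_def by blast
      then have "coprime d (p ^ k)"
        using p(1) by (metis coprime_commute coprime_power_right_iff prime_imp_coprime)
      then have "d dvd N'" using d N_eq by (simp add: smooth_divisors_def coprime_dvd_mult_left_iff)
      then show "d \<in> smooth_divisors N' q" using d by (simp add: smooth_divisors_def)
    qed
    have bound: "q \<le> 1 + \<Sum>(smooth_divisors N' q)" if "prime q" "q dvd N" for q
    proof -
      have "q \<le> 1 + \<Sum>(smooth_divisors N q)" using less.prems that by (simp add: stewart_def)
      also have "\<Sum>(smooth_divisors N q) \<le> \<Sum>(smooth_divisors N' q)"
        using N'0 by (intro sum_nat_mono_subset smooth p_max[OF that] finite_smooth_divisors)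
      finally show ?thesis by simp
    qed
    have "stewart N'" using bound N'0 N_eq unfolding stewart_def by (metis dvd_mult2)
    then have "subset_sum_complete N'" using less.IH less_N by blast
    moreover have "p \<le> 1 + sigma N'"
      using bound[OF p] sum_smooth_divisors_le_sigma[OF N'0, of p] by linarith
    ultimately show ?thesis
      using subset_sum_complete_mult_prime_power[OF N'0 p(1) N'(2)] N_eq by simp
  qed
qed

text \<open>The summands representing \<open>p - 1\<close> are smaller than \<open>p\<close>, and so
  are their prime factors. The bound is applied later also to primes that may not divide
  \<open>N\<close>.\<close>

lemma practical_imp_le_smooth_divisors:
  assumes pr: "practical N" and p: "1 < p" "p \<le> N + 1"
  shows "p \<le> 1 + \<Sum>(smooth_divisors N p)"
proof -
  have N: "N > 0" using pr by (simp add: practical_def)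
  have "p - 1 \<in> {1..N}" using p by auto
  then obtain S where S: "S \<subseteq> {d. d dvd N}" "\<Sum>S = p - 1" using pr unfolding practical_def by blast
  have finS: "finite S" using S(1) N finite_subset by fastforce
  have "S \<subseteq> smooth_divisors N p"
  proof
    fix d assume d: "d \<in> S"
    have "d \<le> p - 1" using member_le_sum[OF d _ finS, of "\<lambda>x. x"] S(2) by simp
    then have "d < p" using p(1) by linarith
    moreover have "d > 0" using d S(1) N by (auto intro: dvd_pos_nat)
    ultimately show "d \<in> smooth_divisors N p"
      using d S(1) by (auto simp: smooth_divisors_def dest!: dvd_imp_le)
  qed
  then have "p - 1 \<le> \<Sum>(smooth_divisors N p)"
    unfolding S(2)[symmetric] using N
    by (intro sum_nat_mono_subset finite_smooth_divisors)
  then show ?thesis by linarith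
qed

lemma practical_iff_stewart: "practical N \<longleftrightarrow> stewart N"
proof
  assume pr: "practical N"
  then have N: "N > 0" by (simp add: practical_def)
  show "stewart N"
    unfolding stewart_def
  proof (intro conjI allI impI N practical_imp_le_smooth_divisors[OF pr])
    fix p assume p: "prime p" "p dvd N"
    show "1 < p" using p(1) by (rule prime_gt_1_nat)
    show "p \<le> N + 1" using dvd_imp_le[OF p(2) N] by simp
  qed
next
  assume st: "stewart N"
  then have N: "N > 0" by (simp add: stewart_def)
  show "practical N"
    using stewart_imp_subset_sum_complete[OF st] le_sigma[OF N] N
    unfolding practical_def subset_sum_complete_def by auto
qed

text \<open>Only a prime \<open>p\<close> of \<open>t\<close> that is new to \<open>M\<close> needs
  an argument. If \<open>M\<close> has a prime above \<open>p\<close>, Stewart's condition at the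
  next such prime covers \<open>p\<close>; otherwise every divisor of \<open>M\<close> is composed
  of primes below \<open>p\<close>, and the bound by \<open>sigma M\<close> applies.\<close>

lemma practical_mult:
  assumes M: "practical M" and t: "t > 0"
    and primes: "\<And>p. prime p \<Longrightarrow> p dvd t \<Longrightarrow> p dvd M \<or> p \<le> 1 + sigma M"
  shows "practical (M * t)"
proof -
  have st: "stewart M" using M by (simp add: practical_iff_stewart)
  then have M0: "M > 0" by (simp add: stewart_def)
  have "p \<le> 1 + \<Sum>(smooth_divisors (M * t) p)" if p: "prime p" "p dvd M * t" for p
  proof -
    have "p \<le> 1 + \<Sum>(smooth_divisors M p)"
    proof (cases "p dvd M")
      case True
      then show ?thesis using st p(1) by (simp add: stewart_def)
    next
      case nd: False
      then have "p \<le> 1 + sigma M" using p primes prime_dvd_mult_iff by blast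
      show ?thesis
      proof (cases "\<exists>q. prime q \<and> q dvd M \<and> p < q")
        case True
        \<comment> \<open>No prime factor of \<open>M\<close> lies between \<open>p\<close> and
          \<open>q\<close>, so both cut out the same divisors of \<open>M\<close>.\<close>
        define q where "q = (LEAST q. prime q \<and> q dvd M \<and> p < q)"
        have q: "prime q" "q dvd M" "p < q" using LeastI_ex[OF True] by (auto simp: q_def)
        have q_le: "q \<le> s" if "prime s" "s dvd M" "p < s" for s
          unfolding q_def using that by (intro Least_le) auto
        have "smooth_divisors M q \<subseteq> smooth_divisors M p"
        proof
          fix d assume d: "d \<in> smooth_divisors M q"
          have "s < p" if s: "prime s" "s dvd d" for s
          proof -
            have "s dvd M" "s < q" using d s by (auto simp: smooth_divisors_def)
            then show ?thesis using q_le[OF s(1)] nd by (metis leD linorder_neqE_nat)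
          qed
          then show "d \<in> smooth_divisors M p" using d by (auto simp: smooth_divisors_def)
        qed
        then have "\<Sum>(smooth_divisors M q) \<le> \<Sum>(smooth_divisors M p)"
          using M0 by (intro sum_nat_mono_subset finite_smooth_divisors)
        moreover have "q \<le> 1 + \<Sum>(smooth_divisors M q)" using st q by (simp add: stewart_def)
        ultimately show ?thesis using q(3) by linarith
      next
        case False
        then have "{d. d dvd M} = smooth_divisors M p"
          using nd by (auto simp: smooth_divisors_def) (metis dvd_trans linorder_neqE_nat)
        then show ?thesis using \<open>p \<le> 1 + sigma M\<close> by (simp add: sigma_def)
      qed
    qed
    also have "\<Sum>(smooth_divisors M p) \<le> \<Sum>(smooth_divisors (M * t) p)"
      using M0 t by (intro sum_nat_mono_subset finite_smooth_divisors) (auto simp: smooth_divisors_def)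
    finally show ?thesis by simp
  qed
  then show ?thesis using M0 t by (auto simp: practical_iff_stewart stewart_def)
qed

corollary practical_mult_le:
  assumes "practical M" "t > 0" "t \<le> 1 + sigma M"
  shows "practical (M * t)"
  using assms by (intro practical_mult) (auto dest: dvd_imp_le)

subsection \<open>Roots modulo prime powers\<close>

definition has_root_mod :: "int \<Rightarrow> int \<Rightarrow> int \<Rightarrow> nat \<Rightarrow> bool" where
  "has_root_mod a b c M \<longleftrightarrow> (\<exists>n::int. int M dvd a * n^2 + b * n + c)"

lemma has_root_mod_dvd:
  assumes "has_root_mod a b c M" "d dvd M"
  shows "has_root_mod a b c d"
  using assms unfolding has_root_mod_def by (meson dvd_trans int_dvd_int_iff)

lemma quadratic_dvd_cong:
  fixes a b c m x y :: int
  assumes "[x = y] (mod m)" "m dvd a * y^2 + b * y + c"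
  shows "m dvd a * x^2 + b * x + c"
proof -
  have "[a * x^2 + b * x + c = a * y^2 + b * y + c] (mod m)"
    using assms(1) by (intro cong_add cong_mult cong_pow cong_refl)
  then show ?thesis using assms(2) cong_dvd_iff by blast
qed

lemma has_root_mod_mult:
  assumes "has_root_mod a b c M" "has_root_mod a b c N" "coprime M N"
  shows "has_root_mod a b c (M * N)"
proof -
  obtain x y where xy: "int M dvd a * x^2 + b * x + c" "int N dvd a * y^2 + b * y + c"
    using assms(1,2) unfolding has_root_mod_def by blast
  have co: "coprime (int M) (int N)" using assms(3) by simp
  obtain z where "[z = x] (mod int M)" "[z = y] (mod int N)"
    using binary_chinese_remainder_int[OF co] by blast
  then have "int M dvd a * z^2 + b * z + c" "int N dvd a * z^2 + b * z + c"
    using xy quadratic_dvd_cong by blast+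
  then have "int M * int N dvd a * z^2 + b * z + c" using co by (rule divides_mult)
  then show ?thesis unfolding has_root_mod_def by auto
qed

text \<open>The Chinese remainder theorem, applied by splitting off one full prime power at a
  time.\<close>

lemma has_root_mod_if_prime_powers:
  assumes "M > 0"
    and "\<And>p k. prime p \<Longrightarrow> p ^ k dvd M \<Longrightarrow> has_root_mod a b c (p ^ k)"
  shows "has_root_mod a b c M"
  using assms
proof (induction M rule: less_induct)
  case (less M)
  show ?case
  proof (cases "M = 1")
    case True
    then show ?thesis by (simp add: has_root_mod_def)
  next
    case False
    then obtain p where p: "prime p" "p dvd M" using prime_factor_nat by blast
    obtain N where N: "M = p ^ multiplicity p M * N" "\<not> p dvd N"
      using multiplicity_decompose'[of M p] less.prems(1) p(1) by (metis less_not_refl not_prime_unit)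
    have "N < M" using N p less.prems(1) by (metis dvd_imp_le dvd_triv_right le_neq_implies_less)
    moreover have "N > 0" using N less.prems(1) by (cases N) auto
    moreover have "N dvd M" using N(1) by (metis dvd_triv_right)
    ultimately have "has_root_mod a b c N" using less.IH less.prems(2) dvd_trans by blast
    moreover have "has_root_mod a b c (p ^ multiplicity p M)"
      by (intro less.prems(2) p(1) multiplicity_dvd)
    moreover have "coprime (p ^ multiplicity p M) N"
      using p(1) N(2) by (simp add: prime_imp_coprime)
    ultimately show ?thesis using has_root_mod_mult N(1) by metis
  qed
qed

lemma enat_le_mq_iff: "enat k \<le> mq a b c p \<longleftrightarrow> has_root_mod a b c (p ^ k)"
proof
  assume le: "enat k \<le> mq a b c p"
  show "has_root_mod a b c (p ^ k)"
  proof (rule ccontr)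
    assume no: "\<not> has_root_mod a b c (p ^ k)"
    \<comment> \<open>Modulo \<open>p ^ 0 = 1\<close> a root always exists; hence
      \<open>k - 1\<close> below is not truncated.\<close>
    then have "k \<noteq> 0" by (auto simp: has_root_mod_def intro!: gr0I)
    have "j < k" if "\<exists>n. (int p) ^ j dvd a * n^2 + b * n + c" for j
    proof (rule ccontr)
      assume "\<not> j < k"
      then have "p ^ k dvd p ^ j" by (simp add: le_imp_power_dvd)
      moreover have "has_root_mod a b c (p ^ j)" using that by (simp add: has_root_mod_def)
      ultimately show False using no has_root_mod_dvd by blast
    qed
    then have "mq a b c p \<le> enat (k - 1)"
      unfolding mq_def by (intro Sup_least) fastforce
    then have "enat k \<le> enat (k - 1)" using le by (rule order_trans[rotated])
    then show False using \<open>k \<noteq> 0\<close> by simp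
  qed
next
  assume "has_root_mod a b c (p ^ k)"
  then show "enat k \<le> mq a b c p"
    unfolding mq_def has_root_mod_def by (intro Sup_upper) auto
qed

lemma mq_eq_infinity_iff: "mq a b c p = \<infinity> \<longleftrightarrow> (\<forall>k. has_root_mod a b c (p ^ k))"
  by (metis enat_le_mq_iff enat_ord_code(3) enat_ord_simps(1) not_infinity_eq not_less_eq_eq order_refl)

text \<open>Hensel lifting: since \<open>p\<close> is odd and does not divide \<open>D\<close>, the
  derivative \<open>2 * y\<close> is invertible modulo \<open>p\<close>, and a root can be corrected
  one power at a time.\<close>

lemma square_mod_prime_power:
  fixes D x :: int
  assumes p: "prime p" "odd p" "\<not> int p dvd D" and x: "int p dvd x^2 - D"
  shows "\<exists>y. int p ^ k dvd y^2 - D"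
proof (cases k)
  case (Suc j)
  have "\<exists>y. int p ^ Suc j dvd y^2 - D" for j
  proof (induction j)
    case 0
    then show ?case using x by auto
  next
    case (Suc j)
    then obtain y where y: "int p ^ Suc j dvd y^2 - D" by blast
    then obtain e where e: "y^2 - D = int p ^ Suc j * e" by blast
    have pi: "prime (int p)" using p(1) by simp
    have "\<not> int p dvd y"
    proof
      assume "int p dvd y"
      then have "int p dvd y^2" by (simp add: power2_eq_square)
      moreover have "int p dvd y^2 - D" using e by simp
      ultimately show False using p(3) by (metis dvd_diff_right_iff)
    qed
    moreover have "\<not> int p dvd 2"
      using p(1,2) by (metis int_dvd_int_iff of_nat_numeral primes_dvd_imp_eq two_is_prime_nat dvd_refl even_iff_mod_2_eq_zero)
    ultimately have "coprime (2 * y) (int p)"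
      using pi by (metis coprime_commute prime_dvd_mult_iff prime_imp_coprime)
    then obtain i where "[2 * y * i = 1] (mod int p)" using cong_solve_coprime_int by blast
    then have "[2 * y * i * (- e) = 1 * (- e)] (mod int p)" by (rule cong_scalar_right)
    then obtain s where "[2 * y * s = - e] (mod int p)" by (simp only: mult.assoc mult_1)
    then have s: "int p dvd 2 * y * s + e" by (simp add: cong_iff_dvd_diff)
    \<comment> \<open>The choice of \<open>s\<close> gains one factor \<open>p\<close> in the linear
      part; the square of the correction contains \<open>p ^ (2 * j + 2)\<close>.\<close>
    have "(y + s * int p ^ Suc j)^2 - D = int p ^ Suc j * (e + 2 * y * s) + int p ^ Suc (Suc j) * (s^2 * int p ^ j)"
      using e by (simp add: power2_eq_square algebra_simps)
    moreover have "int p ^ Suc (Suc j) dvd int p ^ Suc j * (e + 2 * y * s)"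
      using s by (auto simp: add.commute mult.commute[of "int p"] intro: mult_dvd_mono)
    ultimately show ?case by (metis dvd_add dvd_triv_left)
  qed
  then show ?thesis using Suc by blast
qed simp

text \<open>Completing the square: $4a q(n) = (2an+b)^2 - D$.\<close>
lemma has_root_mod_if_square:
  fixes a b c x :: int
  assumes co: "coprime (int M) (2 * a)" and x: "int M dvd x^2 - (b^2 - 4 * a * c)"
  shows "has_root_mod a b c M"
proof -
  obtain i where i: "[2 * a * i = 1] (mod int M)"
    using co cong_solve_coprime_int by (metis coprime_commute)
  define n where "n = i * (x - b)"
  have "[2 * a * n + b = x] (mod int M)"
    using cong_add[OF cong_mult[OF i cong_refl[of "x - b"]] cong_refl[of b]] by (simp add: n_def mult.assoc)
  then have "[(2 * a * n + b)^2 - (b^2 - 4 * a * c) = x^2 - (b^2 - 4 * a * c)] (mod int M)"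
    by (intro cong_diff cong_pow cong_refl)
  then have "int M dvd (2 * a * n + b)^2 - (b^2 - 4 * a * c)" using x cong_dvd_iff by blast
  also have "(2 * a * n + b)^2 - (b^2 - 4 * a * c) = (2 * a) * (2 * (a * n^2 + b * n + c))"
    by (simp add: power2_eq_square algebra_simps)
  finally have "int M dvd 2 * (a * n^2 + b * n + c)" using co by (simp add: coprime_dvd_mult_right_iff)
  moreover have "coprime (int M) 2" using co coprime_mult_right_iff by blast
  ultimately have "int M dvd a * n^2 + b * n + c" using coprime_dvd_mult_right_iff by blast
  then show ?thesis unfolding has_root_mod_def by blast
qed

subsection \<open>Abundant moduli with a root\<close>

lemma sum_inverse_divisors:
  assumes "N > 0"
  shows "(\<Sum>d | d dvd N. 1 / real d) = real (sigma N) / real N"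
proof -
  have "(\<Sum>d | d dvd N. 1 / real d) = (\<Sum>d | d dvd N. real (N div d) / real N)"
    using assms by (intro sum.cong) (auto simp: real_of_nat_div field_simps)
  also have "\<dots> = (\<Sum>d | d dvd N. real d / real N)"
    using assms by (intro sum.reindex_bij_witness[of _ "\<lambda>d. N div d" "\<lambda>d. N div d"])
      (auto simp: div_dvd_iff_mult)
  finally show ?thesis by (simp add: sigma_def sum_divide_distrib)
qed

text \<open>Transfers the abundance of \<open>B\<close> to every multiple: the quotient is the sum
  of the reciprocals of the divisors.\<close>

lemma sigma_div_mono:
  assumes "M > 0" "N > 0" "N dvd M"
  shows "real (sigma N) / real N \<le> real (sigma M) / real M"
proof -
  have "(\<Sum>d | d dvd N. 1 / real d) \<le> (\<Sum>d | d dvd M. 1 / real d)"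
    using assms by (intro sum_mono2) (auto intro: dvd_trans)
  then show ?thesis using assms by (simp add: sum_inverse_divisors)
qed

section \<open>The norm X^2 - D Y^2 of X + Y sqrt(D) and its primitive representations\<close>

definition norm_form :: "int \<Rightarrow> int \<times> int \<Rightarrow> int" where
  "norm_form D z = (fst z)^2 - D * (snd z)^2"

text \<open>Two equal fractions in lowest terms with positive numerators agree termwise.\<close>

lemma coprime_cross_eq:
  fixes X Y X' Y' :: int
  assumes "X * Y' = X' * Y" "coprime X Y" "coprime X' Y'" "X > 0" "X' > 0"
  shows "X = X' \<and> Y = Y'"
proof -
  have "X dvd X' * Y" "X' dvd X * Y'" using assms(1) by (metis dvd_triv_left)+
  then have "X dvd X'" "X' dvd X" using assms(2,3) by (simp_all add: coprime_dvd_mult_left_iff)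
  then have "X = X'" using assms(4,5) by (simp add: zdvd_antisym_nonneg)
  then show ?thesis using assms by simp
qed

text \<open>Two primitive representations of $d$ by $X^2 - DY^2$ are separated by
  $\gcd(d, X Y_0 - X_0 Y)$ for a fixed reference representation $(X_0, Y_0)$ of $d$, so $d$ has
  at most as many representations as divisors; and $\sum_{d \mid B} \tau(d)/d \le (\sigma(B)/B)^2$.\<close>
lemma sum_inverse_norm_form_le:
  fixes P :: "(int \<times> int) set"
  assumes fin: "finite P"
    and pos: "\<And>z. z \<in> P \<Longrightarrow> fst z > 0" "\<And>z. z \<in> P \<Longrightarrow> norm_form D z > 0"
    and prim: "\<And>z. z \<in> P \<Longrightarrow> coprime (fst z) (snd z)"
    and co: "\<And>z. z \<in> P \<Longrightarrow> coprime (norm_form D z) (2 * fst z * snd z)"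
    and sep: "\<And>z z'. z \<in> P \<Longrightarrow> z' \<in> P \<Longrightarrow> norm_form D z = norm_form D z' \<Longrightarrow>
      \<bar>fst z * snd z' - fst z' * snd z\<bar> < norm_form D z"
    and B: "B > 0" "\<And>z. z \<in> P \<Longrightarrow> norm_form D z dvd int B"
  shows "(\<Sum>z\<in>P. 1 / real_of_int (norm_form D z)) \<le> (real (sigma B) / real B)^2"
proof -
  define rep where "rep d = (SOME z. z \<in> P \<and> norm_form D z = d)" for d
  have rep: "rep (norm_form D z) \<in> P" "norm_form D (rep (norm_form D z)) = norm_form D z"
    if "z \<in> P" for z
    using someI[of "\<lambda>y. y \<in> P \<and> norm_form D y = norm_form D z" z] that by (auto simp: rep_def)
  define cross where "cross z w = fst z * snd w - fst w * snd z" for z w :: "int \<times> int"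
  \<comment> \<open>For a norm d, \<open>e z\<close> collects the part of d dividing the cross
    product with the reference, and \<open>f z\<close> is the complementary factor; the pair
    determines both d and \<open>z\<close>.\<close>
  define e where "e z = gcd (norm_form D z) (cross z (rep (norm_form D z)))" for z
  define f where "f z = norm_form D z div e z" for z
  have ef: "norm_form D z = e z * f z" for z by (simp add: e_def f_def)
  have e_pos: "e z > 0" if "z \<in> P" for z using pos(2)[OF that] by (simp add: e_def)
  have f_pos: "f z > 0" if "z \<in> P" for z
    using pos(2)[OF that] e_pos[OF that] ef[of z] by (simp add: zero_less_mult_iff)
  have e_dvd: "e z dvd cross z (rep (norm_form D z))" for z by (simp add: e_def)
  have f_dvd: "f z dvd fst z * snd (rep (norm_form D z)) + fst (rep (norm_form D z)) * snd z"
    if z: "z \<in> P" for z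
  proof -
    define w where "w = rep (norm_form D z)"
    have w: "norm_form D w = norm_form D z" using rep z by (simp add: w_def)
    define u where "u = fst z * snd w + fst w * snd z"
    \<comment> \<open>Conjugation: the two sign choices multiply to a multiple of the common norm,
      so what the gcd leaves of the norm must divide the other factor \<open>u\<close>.\<close>
    have "cross z w * u = norm_form D z * (snd w)^2 - norm_form D w * (snd z)^2"
      by (simp add: cross_def u_def norm_form_def power2_eq_square algebra_simps)
    then have "norm_form D z dvd cross z w * u" using w by simp
    moreover obtain t where t: "cross z w = e z * t" using e_dvd[of z] by (auto simp: w_def)
    ultimately have "e z * f z dvd e z * (t * u)" using ef[of z] by (simp add: mult.assoc)
    then have "f z dvd t * u" using e_pos[OF z] by simp
    moreover have "coprime (f z) t"
    proof -
      have "coprime (norm_form D z div e z) (cross z w div e z)"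
        unfolding e_def w_def using pos(2)[OF z] by (intro div_gcd_coprime) auto
      then show ?thesis using t e_pos[OF z] by (simp add: f_def)
    qed
    ultimately show ?thesis by (simp add: coprime_dvd_mult_right_iff u_def w_def)
  qed
  define \<phi> where "\<phi> z = (nat (e z), nat (f z))" for z
  have inj: "inj_on \<phi> P"
  proof (rule inj_onI)
    fix z z' assume z: "z \<in> P" and z': "z' \<in> P" and eq: "\<phi> z = \<phi> z'"
    have e_eq: "e z' = e z" and f_eq: "f z' = f z"
      using eq e_pos[OF z] e_pos[OF z'] f_pos[OF z] f_pos[OF z'] by (auto simp: \<phi>_def)
    then have d_eq: "norm_form D z' = norm_form D z" using ef by simp
    define w where "w = rep (norm_form D z)"
    have w: "w \<in> P" "norm_form D w = norm_form D z" using rep z by (simp_all add: w_def)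
    have co_w: "coprime (norm_form D z) (snd w)" using co[OF w(1)] w(2) by simp
    \<comment> \<open>This combination eliminates \<open>fst w\<close>; the remaining factor
      \<open>snd w\<close> is prime to the norm.\<close>
    have "e z dvd snd z' * cross z w - snd z * cross z' w"
      using e_dvd[of z] e_dvd[of z'] e_eq d_eq by (auto simp: w_def intro!: dvd_diff)
    then have "e z dvd snd w * cross z z'" by (simp add: cross_def algebra_simps)
    moreover have "coprime (e z) (snd w)" using co_w ef[of z] by simp
    ultimately have 1: "e z dvd cross z z'" by (simp add: coprime_dvd_mult_right_iff)
    have "f z dvd snd z' * (fst z * snd w + fst w * snd z) - snd z * (fst z' * snd w + fst w * snd z')"
      using f_dvd[OF z] f_dvd[OF z'] f_eq d_eq by (intro dvd_diff dvd_mult) (auto simp: w_def)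
    then have "f z dvd snd w * cross z z'" by (simp add: cross_def algebra_simps)
    moreover have "coprime (f z) (snd w)" using co_w ef[of z] by simp
    ultimately have 2: "f z dvd cross z z'" by (simp add: coprime_dvd_mult_right_iff)
    \<comment> \<open>A common divisor divides the sum \<open>2 * fst z * snd w\<close> of the two
      sign choices, which is prime to the norm.\<close>
    have "coprime (e z) (f z)"
    proof (rule coprimeI)
      fix g assume g: "g dvd e z" "g dvd f z"
      have "g dvd cross z w" using g(1) e_dvd[of z] by (auto simp: w_def)
      moreover have "g dvd fst z * snd w + fst w * snd z" using g(2) f_dvd[OF z] by (auto simp: w_def)
      ultimately have "g dvd cross z w + (fst z * snd w + fst w * snd z)" by (rule dvd_add)
      then have "g dvd 2 * fst z * snd w" by (simp add: cross_def algebra_simps)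
      moreover have "coprime (norm_form D z) (2 * fst z * snd w)"
        using co[OF z] co_w by simp
      moreover have "g dvd norm_form D z" using g(1) ef[of z] by simp
      ultimately show "is_unit g" by (meson coprime_common_divisor)
    qed
    then have "e z * f z dvd cross z z'" using 1 2 by (intro divides_mult)
    then have "norm_form D z dvd cross z z'" using ef by simp
    \<comment> \<open>A multiple of the norm smaller than the norm vanishes, so the pairs are
      proportional.\<close>
    moreover have "\<bar>cross z z'\<bar> < norm_form D z"
      using sep[OF z z'] d_eq by (simp add: cross_def)
    ultimately have "cross z z' = 0" using dvd_imp_le_int[of "cross z z'" "norm_form D z"] by linarith
    then have "fst z * snd z' = fst z' * snd z" by (simp add: cross_def)
    then have "fst z = fst z' \<and> snd z = snd z'"
      by (rule coprime_cross_eq[OF _ prim[OF z] prim[OF z'] pos(1)[OF z] pos(1)[OF z']])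
    then show "z = z'" by (simp add: prod_eq_iff)
  qed
  let ?D = "{d. d dvd B}"
  have finD: "finite ?D" using finite_divisors_nat[OF B(1)] .
  have img: "\<phi> ` P \<subseteq> ?D \<times> ?D"
  proof
    fix v assume "v \<in> \<phi> ` P"
    then obtain z where z: "z \<in> P" "v = \<phi> z" by blast
    have "e z dvd int B" "f z dvd int B" using B(2)[OF z(1)] ef[of z] by (auto intro: dvd_mult_left dvd_mult_right)
    then have "nat (e z) dvd B" "nat (f z) dvd B" using e_pos[OF z(1)] f_pos[OF z(1)]
      by (simp_all add: nat_dvd_iff)
    then show "v \<in> ?D \<times> ?D" using z(2) by (simp add: \<phi>_def)
  qed
  have "(\<Sum>z\<in>P. 1 / real_of_int (norm_form D z)) = (\<Sum>z\<in>P. (\<lambda>v. 1 / real (fst v) * (1 / real (snd v))) (\<phi> z))"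
    using e_pos f_pos by (intro sum.cong refl) (simp add: \<phi>_def ef less_imp_le)
  also have "\<dots> = (\<Sum>v\<in>\<phi> ` P. 1 / real (fst v) * (1 / real (snd v)))"
    using inj by (simp add: sum.reindex)
  also have "\<dots> \<le> (\<Sum>v\<in>?D \<times> ?D. 1 / real (fst v) * (1 / real (snd v)))"
    by (rule sum_mono2[OF finite_cartesian_product[OF finD finD] img]) simp
  also have "\<dots> = (\<Sum>d\<in>?D. 1 / real d) * (\<Sum>d\<in>?D. 1 / real d)"
    unfolding sum_product sum.cartesian_product by (simp add: case_prod_unfold)
  also have "\<dots> = (real (sigma B) / real B)^2"
    using sum_inverse_divisors[OF B(1)] by (simp add: power2_eq_square)
  finally show ?thesis .
qed

section \<open>Primitive pairs in a cone and the divergence of their reciprocal norms\<close>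

text \<open>The slope \<open>4 * \<bar>D\<bar>\<close> keeps the norm comparable with X^2 whatever
  the sign of \<open>D\<close>. Divisibility of Y by \<open>m\<close> later keeps the norm prime to
  \<open>2 * a * D\<close>.\<close>

definition cone_pairs :: "int \<Rightarrow> int \<Rightarrow> int \<Rightarrow> (int \<times> int) set" where
  "cone_pairs D m Z = {(X, Y). 0 < X \<and> X \<le> Z \<and> 0 < Y \<and> m dvd Y \<and> coprime X Y \<and> 4 * \<bar>D\<bar> * Y \<le> X}"

text \<open>The cone gives 16 |D| Y^2 \<le> X^2, so D Y^2 perturbs X^2 by at most a
  sixteenth.\<close>

lemma norm_form_cone_bounds:
  fixes X Y D :: int
  assumes "D \<noteq> 0" "0 < X" "0 < Y" "4 * \<bar>D\<bar> * Y \<le> X"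
  shows "4 * Y \<le> X" "X^2 < 2 * norm_form D (X, Y)" "norm_form D (X, Y) \<le> 2 * X^2"
proof -
  have D: "\<bar>D\<bar> \<ge> 1" using assms(1) by linarith
  have Y: "Y \<le> \<bar>D\<bar> * Y" using mult_right_mono[OF D, of Y] assms(3) by simp
  then show le: "4 * Y \<le> X" using assms(4) by linarith
  have "\<bar>D\<bar> * Y^2 = (\<bar>D\<bar> * Y) * Y" by (simp add: power2_eq_square)
  moreover have "(4 * (\<bar>D\<bar> * Y)) * (4 * Y) \<le> X * X"
    using assms le by (intro mult_mono) auto
  ultimately have bound: "16 * (\<bar>D\<bar> * Y^2) \<le> X^2" by (simp add: power2_eq_square)
  have "\<bar>D * Y^2\<bar> = \<bar>D\<bar> * Y^2" by (simp add: abs_mult)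
  moreover have "X^2 > 0" using assms(2) by simp
  ultimately have "2 * (D * Y^2) < X^2 \<and> - (D * Y^2) \<le> X^2" using bound by linarith
  then show "X^2 < 2 * norm_form D (X, Y)" "norm_form D (X, Y) \<le> 2 * X^2"
    by (simp_all add: norm_form_def)
qed

text \<open>Both cross terms are positive and at most X X' / 4, while X X' is less than twice the
  common norm.\<close>

lemma cone_pairs_separated:
  assumes "D \<noteq> 0" "z \<in> cone_pairs D m Z" "z' \<in> cone_pairs D m Z" "norm_form D z = norm_form D z'"
  shows "\<bar>fst z * snd z' - fst z' * snd z\<bar> < norm_form D z"
proof -
  obtain X Y X' Y' where z: "z = (X, Y)" "z' = (X', Y')" by (cases z, cases z')
  have pos: "0 < X" "0 < Y" "0 < X'" "0 < Y'" using assms(2,3) z by (auto simp: cone_pairs_def)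
  have b: "4 * Y \<le> X" "X^2 < 2 * norm_form D z" "4 * Y' \<le> X'" "X'^2 < 2 * norm_form D z"
    using norm_form_cone_bounds[of D X Y] norm_form_cone_bounds[of D X' Y'] assms z
    by (auto simp: cone_pairs_def)
  have "2 * (X * X') \<le> X^2 + X'^2" using zero_le_power2[of "X - X'"] by (simp add: power2_diff)
  then have "X * X' < 2 * norm_form D z" using b(2,4) by linarith
  moreover have "X * (4 * Y') \<le> X * X'" "X' * (4 * Y) \<le> X' * X"
    using b pos by (intro mult_left_mono; simp)+
  moreover have "0 < X * Y'" "0 < X' * Y" using pos by simp_all
  ultimately show ?thesis using z by (simp add: mult.commute)
qed

text \<open>The norm is X^2 modulo Y and - D Y^2 modulo X; moreover 2 and \<open>D\<close> divide Y,
  which is prime to X.\<close>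

lemma cone_pairs_coprime:
  assumes "2 dvd m" "D dvd m" "z \<in> cone_pairs D m Z"
  shows "coprime (norm_form D z) (2 * fst z * snd z)"
proof -
  obtain X Y where z: "z = (X, Y)" by (cases z)
  have XY: "coprime X Y" and Y: "2 dvd Y" "D dvd Y"
    using assms z by (auto simp: cone_pairs_def intro: dvd_trans)
  have XD: "coprime X D" using XY Y(2) coprime_divisors dvd_refl by blast
  have 1: "coprime (norm_form D z) Y"
  proof (rule coprimeI)
    fix g assume g: "g dvd norm_form D z" "g dvd Y"
    have "g dvd norm_form D z + D * Y^2" using g by (simp add: power2_eq_square)
    then have "g dvd X^2" by (simp add: norm_form_def z)
    moreover have "coprime (X^2) Y" using XY by simp
    ultimately show "is_unit g" using g(2) by (meson coprime_common_divisor)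
  qed
  have 2: "coprime (norm_form D z) X"
  proof (rule coprimeI)
    fix g assume g: "g dvd norm_form D z" "g dvd X"
    have "g dvd X^2 - norm_form D z" using g by (simp add: power2_eq_square)
    then have "g dvd D * Y^2" by (simp add: norm_form_def z)
    moreover have "coprime (D * Y^2) X" using XY XD by (simp add: coprime_commute)
    ultimately show "is_unit g" using g(2) by (meson coprime_common_divisor)
  qed
  have "coprime (norm_form D z) 2" using 1 Y(1) coprime_divisors dvd_refl by blast
  then show ?thesis using 1 2 z by simp
qed

lemma finite_cone_pairs: "D \<noteq> 0 \<Longrightarrow> finite (cone_pairs D m Z)"
proof (rule finite_subset)
  assume D: "D \<noteq> 0"
  show "cone_pairs D m Z \<subseteq> {0..Z} \<times> {0..Z}"
    using norm_form_cone_bounds(1)[OF D] unfolding cone_pairs_def by fastforce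
qed simp

lemma sum_inverse_squares_le: "(\<Sum>g=1..n. 1 / real g ^ 2) \<le> 2"
proof -
  \<comment> \<open>The sharper bound makes the induction telescope.\<close>
  have "(\<Sum>g=1..n. 1 / real g ^ 2) \<le> 2 - 1 / real n" if "n \<ge> 1"
    using that
  proof (induction n rule: dec_induct)
    case (step n)
    have "1 / real (Suc n) ^ 2 \<le> 1 / (real n * real (Suc n))"
      using step(1) by (intro divide_left_mono) (auto simp: power2_eq_square)
    also have "\<dots> = 1 / real n - 1 / real (Suc n)"
      using step(1) by (simp add: field_simps)
    finally show ?case using step by simp
  qed simp
  then show ?thesis by (cases "n = 0") (auto intro: order_trans)
qed

text \<open>All pairs $(1 + Lj, my)$ with $y \le j$ contribute a multiple of the harmonic sum; dividing out
  the gcd $g$ maps them to primitive pairs at the cost of the convergent factor $\sum_g g^{-2}$.\<close>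
lemma harm_le_sum_cone_pairs:
  fixes D m :: int
  assumes D: "D \<noteq> 0" and m: "m > 0"
  defines "L \<equiv> 4 * \<bar>D\<bar> * m"
  shows "harm J \<le> 8 * real_of_int L ^ 2 *
    (\<Sum>z\<in>cone_pairs D m (1 + L * int J). 1 / real_of_int (fst z) ^ 2)"
proof -
  define Z where "Z = 1 + L * int J"
  let ?P = "cone_pairs D m Z"
  have L: "L > 0" using D m by (simp add: L_def)
  define A where "A = (SIGMA j:{1..J}. {1..j})"
  \<comment> \<open>As \<open>L\<close> is \<open>4 * \<bar>D\<bar> * m\<close>, the pair lies in
    the cone whenever y \<le> j, and \<open>X j\<close> is 1 modulo \<open>m\<close>.\<close>
  define X where "X j = 1 + L * int j" for j
  define G where "G v = gcd (X (fst v)) (m * int (snd v))" for v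
  define \<phi> where "\<phi> v = (nat (G v), (X (fst v) div G v, (m * int (snd v)) div G v))" for v
  have X_pos: "X j > 0" for j using L by (simp add: X_def add_pos_nonneg)
  have G_pos: "G v > 0" for v using X_pos[of "fst v"] by (simp add: G_def)
  have G_X: "X (fst v) = G v * (X (fst v) div G v)" for v by (simp add: G_def)
  have G_Y: "m * int (snd v) = G v * ((m * int (snd v)) div G v)" for v by (simp add: G_def)
  have inj: "inj_on \<phi> A"
  proof (rule inj_onI)
    fix v w assume eq: "\<phi> v = \<phi> w"
    have "G v = G w" using eq G_pos[of v] G_pos[of w] by (auto simp: \<phi>_def)
    then have "X (fst v) = X (fst w)" "m * int (snd v) = m * int (snd w)"
      using eq G_X[of v] G_X[of w] G_Y[of v] G_Y[of w] by (auto simp: \<phi>_def)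
    then show "v = w" using L m by (auto simp: X_def prod_eq_iff)
  qed
  have img: "\<phi> ` A \<subseteq> {1..nat Z} \<times> ?P"
  proof
    fix u assume "u \<in> \<phi> ` A"
    then obtain v where v: "v \<in> A" "u = \<phi> v" by blast
    obtain j y where jy: "v = (j, y)" by (cases v)
    have y: "1 \<le> y" "y \<le> j" "j \<le> J" using v(1) jy by (auto simp: A_def)
    define g where "g = G v"
    define X1 where "X1 = X j div g"
    define Y1 where "Y1 = m * int y div g"
    have g: "g > 0" using G_pos by (simp add: g_def)
    have X1: "X j = g * X1" and Y1: "m * int y = g * Y1"
      using G_X[of v] G_Y[of v] by (simp_all add: jy g_def X1_def Y1_def)
    have "0 < g * X1" "0 < g * Y1" using X_pos[of j] m y(1) by (simp_all flip: X1 Y1)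
    then have pos: "0 < X1" "0 < Y1" using g by (simp_all add: zero_less_mult_iff)
    have XZ: "X j \<le> Z" using y L by (simp add: X_def Z_def)
    have le_mult: "t \<le> s * t" if "s > 0" "t > 0" for s t :: int
      using mult_right_mono[of 1 s t] that by simp
    have XZ1: "g \<le> Z" "X1 \<le> Z"
      using XZ X1 le_mult[OF g pos(1)] le_mult[OF pos(1) g] by (simp_all add: mult.commute)
    have "L * int y \<le> X j" using y L by (simp add: X_def add_increasing)
    moreover have "L * int y = 4 * \<bar>D\<bar> * (m * int y)" by (simp add: L_def)
    then have "L * int y = g * (4 * \<bar>D\<bar> * Y1)" unfolding Y1 by simp
    ultimately have "g * (4 * \<bar>D\<bar> * Y1) \<le> g * X1" using X1 by simp
    then have cone: "4 * \<bar>D\<bar> * Y1 \<le> X1" using g by simp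
    \<comment> \<open>Because \<open>X j\<close> is 1 modulo \<open>m\<close>, the gcd divides y
      alone, and the factor \<open>m\<close> of the second entry survives the division.\<close>
    have "coprime g m"
    proof (rule coprimeI)
      fix h assume h: "h dvd g" "h dvd m"
      then have "h dvd X j" "h dvd L * int j" using X1 by (simp_all add: L_def)
      then have "h dvd X j - L * int j" by (rule dvd_diff)
      then show "is_unit h" by (simp add: X_def)
    qed
    moreover have "g dvd m * int y" using Y1 by simp
    ultimately obtain y1 where "int y = g * y1" by (auto simp: coprime_dvd_mult_right_iff)
    then have "Y1 = m * y1" using Y1 g by simp
    then have "m dvd Y1" by simp
    moreover have "coprime X1 Y1"
      using X_pos[of j] unfolding X1_def Y1_def g_def G_def jy fst_conv snd_conv
      by (intro div_gcd_coprime) auto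
    ultimately have "(X1, Y1) \<in> ?P" using pos XZ1 cone by (simp add: cone_pairs_def)
    moreover have "u = (nat g, (X1, Y1))" using v(2) by (simp add: \<phi>_def jy g_def X1_def Y1_def)
    ultimately show "u \<in> {1..nat Z} \<times> ?P" using g XZ1 by auto
  qed
  have finP: "finite ({1..nat Z} \<times> ?P)" using finite_cone_pairs[OF D] by simp
  have "(\<Sum>v\<in>A. 1 / real_of_int (X (fst v)) ^ 2)
      = (\<Sum>v\<in>A. (\<lambda>u. 1 / real (fst u) ^ 2 * (1 / real_of_int (fst (snd u)) ^ 2)) (\<phi> v))"
  proof (intro sum.cong refl)
    fix v
    have "real_of_int (X (fst v)) = real_of_int (G v) * real_of_int (X (fst v) div G v)"
      using G_X[of v] by (metis of_int_mult)
    then show "1 / real_of_int (X (fst v)) ^ 2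
      = (\<lambda>u. 1 / real (fst u) ^ 2 * (1 / real_of_int (fst (snd u)) ^ 2)) (\<phi> v)"
      using G_pos[of v] by (simp add: \<phi>_def power_mult_distrib)
  qed
  also have "\<dots> = (\<Sum>u\<in>\<phi> ` A. 1 / real (fst u) ^ 2 * (1 / real_of_int (fst (snd u)) ^ 2))"
    using inj by (simp add: sum.reindex)
  also have "\<dots> \<le> (\<Sum>u\<in>{1..nat Z} \<times> ?P. 1 / real (fst u) ^ 2 * (1 / real_of_int (fst (snd u)) ^ 2))"
    by (rule sum_mono2[OF finP img]) simp
  also have "\<dots> = (\<Sum>g=1..nat Z. 1 / real g ^ 2) * (\<Sum>z\<in>?P. 1 / real_of_int (fst z) ^ 2)"
    unfolding sum_product sum.cartesian_product by (simp add: case_prod_unfold)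
  also have "\<dots> \<le> 2 * (\<Sum>z\<in>?P. 1 / real_of_int (fst z) ^ 2)"
    by (intro mult_right_mono sum_inverse_squares_le sum_nonneg) simp
  finally have upper: "(\<Sum>v\<in>A. 1 / real_of_int (X (fst v)) ^ 2)
    \<le> 2 * (\<Sum>z\<in>?P. 1 / real_of_int (fst z) ^ 2)" .
  \<comment> \<open>For each j the j equal terms are at least j / (2 L j)^2 = 1 / (4 L^2 j), using
    \<open>X j\<close> \<le> 2 L j.\<close>
  have "harm J / (4 * real_of_int L ^ 2) = (\<Sum>j=1..J. 1 / (4 * real_of_int L ^ 2 * real j))"
    by (simp add: harm_def sum_divide_distrib field_simps)
  also have "\<dots> \<le> (\<Sum>j=1..J. \<Sum>y=1..j. 1 / real_of_int (X j) ^ 2)"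
  proof (rule sum_mono)
    fix j assume j: "j \<in> {1..J}"
    have Lj: "1 \<le> L * int j" using L j mult_mono[of 1 L 1 "int j"] by simp
    have "real_of_int (X j) \<le> real_of_int (2 * (L * int j))"
      unfolding of_int_le_iff X_def using Lj by linarith
    then have "real_of_int (X j) ^ 2 \<le> (2 * (real_of_int L * real j)) ^ 2"
      using X_pos[of j] by (intro power_mono) auto
    then have "real j / (2 * (real_of_int L * real j)) ^ 2 \<le> real j / real_of_int (X j) ^ 2"
      using X_pos[of j] L j by (intro divide_left_mono) auto
    also have "real j / (2 * (real_of_int L * real j)) ^ 2 = 1 / (4 * real_of_int L ^ 2 * real j)"
      using j by (simp add: power2_eq_square)
    finally show "1 / (4 * real_of_int L ^ 2 * real j) \<le> (\<Sum>y=1..j. 1 / real_of_int (X j) ^ 2)"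
      by simp
  qed
  also have "\<dots> = (\<Sum>v\<in>A. 1 / real_of_int (X (fst v)) ^ 2)"
    unfolding A_def by (subst sum.Sigma) (auto simp: case_prod_unfold)
  finally have "harm J / (4 * real_of_int L ^ 2) \<le> 2 * (\<Sum>z\<in>?P. 1 / real_of_int (fst z) ^ 2)"
    using upper by linarith
  then show ?thesis using L by (simp add: Z_def field_simps)
qed

text \<open>Dividing by Y, invertible modulo \<open>p\<close>, makes \<open>D\<close> a square
  modulo \<open>p\<close>. As \<open>p\<close> is prime to \<open>2 * a * D\<close>, this square
  root lifts to all powers and yields roots of the quadratic.\<close>

lemma prime_dvd_norm_form_imp_has_root:
  fixes a b c :: int
  assumes D: "D = b^2 - 4 * a * c" and m: "2 * a * D dvd m" and z: "z \<in> cone_pairs D m Z"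
    and p: "prime p" "int p dvd norm_form D z"
  shows "has_root_mod a b c (p ^ k)"
proof -
  obtain X Y where XY: "z = (X, Y)" by (cases z)
  have Y: "m dvd Y" "coprime X Y" using z XY by (auto simp: cone_pairs_def)
  have "2 dvd m" "D dvd m" using m by (auto intro: dvd_trans)
  then have "coprime (norm_form D z) (2 * fst z * snd z)" using z by (rule cone_pairs_coprime)
  then have "coprime (norm_form D z) Y" using XY by simp
  then have pY: "coprime (int p) Y" using p(2) coprime_divisors dvd_refl by blast
  then have co: "coprime (int p) (2 * a * D)"
    using Y(1) m by (meson coprime_divisors dvd_refl dvd_trans)
  obtain i where i: "[Y * i = 1] (mod int p)"
    using pY cong_solve_coprime_int by (metis coprime_commute)
  have "int p dvd i^2 * norm_form D z" using p(2) by simp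
  also have "i^2 * norm_form D z = (X * i)^2 - D * (Y * i)^2"
    by (simp add: norm_form_def XY power2_eq_square algebra_simps)
  finally have "[(X * i)^2 = D * (Y * i)^2] (mod int p)" by (simp add: cong_iff_dvd_diff)
  also have "[D * (Y * i)^2 = D * 1^2] (mod int p)"
    using i by (intro cong_mult cong_pow cong_refl)
  finally have sq: "int p dvd (X * i)^2 - D" by (simp add: cong_iff_dvd_diff)
  have "coprime (int p) 2" "coprime (int p) D" using co by simp_all
  moreover have "int p \<noteq> 1" using p(1) by (metis not_prime_1 of_nat_eq_1_iff)
  ultimately have "odd p" "\<not> int p dvd D"
    using prime_gt_1_nat[OF p(1)] by (auto simp: coprime_absorb_left)
  then obtain y where "int p ^ k dvd y^2 - D"
    using square_mod_prime_power[OF p(1) _ _ sq] by blast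
  moreover have "coprime (int p ^ k) (2 * a)" using co by simp
  ultimately show ?thesis by (intro has_root_mod_if_square[where x = y]) (simp_all add: D)
qed

section \<open>Moduli of arbitrarily large abundance\<close>

lemma ex_harm_ge: "\<exists>J. harm J \<ge> (R::real)"
  using harm_at_top by (auto simp: filterlim_at_top eventually_sequentially)

lemma ex_abundant_nonzero_discriminant:
  fixes a b c :: int
  assumes a: "a > 0" and D: "b^2 - 4 * a * c \<noteq> 0"
  shows "\<exists>B>0. (\<forall>p k. prime p \<longrightarrow> p dvd B \<longrightarrow> has_root_mod a b c (p ^ k)) \<and> K * B \<le> sigma B"
proof -
  define D where "D = b^2 - 4 * a * c"
  define m where "m = 2 * a * \<bar>D\<bar>"
  define L where "L = 4 * \<bar>D\<bar> * m"
  have D0: "D \<noteq> 0" and m: "m > 0" "2 dvd m" "D dvd m" "2 * a * D dvd m"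
    using a assms(2) by (auto simp: D_def m_def)
  have L: "L > 0" using D0 m(1) by (simp add: L_def)
  \<comment> \<open>The factor 16 is 8 from the harmonic bound times 2 from norm \<le> 2 X^2;
    \<open>K\<close> is squared because the divisor sum enters squared.\<close>
  obtain J where J: "harm J \<ge> real K ^ 2 * (16 * real_of_int L ^ 2)"
    using ex_harm_ge by blast
  let ?P = "cone_pairs D m (1 + L * int J)"
  have fin: "finite ?P" using finite_cone_pairs[OF D0] .
  have bounds: "fst z > 0" "coprime (fst z) (snd z)" "norm_form D z > 0"
    "norm_form D z \<le> 2 * (fst z)^2" if "z \<in> ?P" for z
  proof -
    obtain X Y where z: "z = (X, Y)" by (cases z)
    then have XY: "0 < X" "0 < Y" "4 * \<bar>D\<bar> * Y \<le> X" "coprime X Y"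
      using that by (auto simp: cone_pairs_def)
    have "X^2 > 0" using XY(1) by simp
    then show "fst z > 0" "coprime (fst z) (snd z)" "norm_form D z > 0"
      "norm_form D z \<le> 2 * (fst z)^2"
      using norm_form_cone_bounds[OF D0 XY(1-3)] XY z by simp_all
  qed
  \<comment> \<open>The product makes each norm a divisor, while every prime of \<open>B\<close>
    still divides some norm.\<close>
  define B where "B = (\<Prod>z\<in>?P. nat (norm_form D z))"
  have B: "B > 0" unfolding B_def using bounds(3) by (intro prod_pos) simp
  have dvd_B: "norm_form D z dvd int B" if "z \<in> ?P" for z
  proof -
    have "nat (norm_form D z) dvd B" unfolding B_def using fin that by (rule dvd_prodI)
    then show ?thesis using bounds(3)[OF that] by (simp add: nat_dvd_iff)
  qed
  have "real K ^ 2 * (16 * real_of_int L ^ 2)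
      \<le> 8 * real_of_int L ^ 2 * (\<Sum>z\<in>?P. 1 / real_of_int (fst z) ^ 2)"
    using J harm_le_sum_cone_pairs[OF D0 m(1), of J] by (simp add: L_def)
  then have "real K ^ 2 \<le> (\<Sum>z\<in>?P. 1 / real_of_int (fst z) ^ 2) / 2"
    using L by (simp add: field_simps)
  also have "\<dots> = (\<Sum>z\<in>?P. 1 / (2 * real_of_int (fst z) ^ 2))"
    by (simp add: sum_divide_distrib mult.commute)
  also have "\<dots> \<le> (\<Sum>z\<in>?P. 1 / real_of_int (norm_form D z))"
  proof (rule sum_mono)
    fix z assume z: "z \<in> ?P"
    have "real_of_int (norm_form D z) \<le> real_of_int (2 * (fst z)^2)"
      using bounds(4)[OF z] by (simp only: of_int_le_iff)
    then show "1 / (2 * real_of_int (fst z) ^ 2) \<le> 1 / real_of_int (norm_form D z)"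
      using bounds(1,3)[OF z] by (intro divide_left_mono) auto
  qed
  also have "\<dots> \<le> (real (sigma B) / real B)^2"
  proof (rule sum_inverse_norm_form_le[OF fin bounds(1) bounds(3) bounds(2)])
    show "coprime (norm_form D z) (2 * fst z * snd z)" if "z \<in> ?P" for z
      using cone_pairs_coprime[OF m(2,3) that] .
    show "\<bar>fst z * snd z' - fst z' * snd z\<bar> < norm_form D z"
      if "z \<in> ?P" "z' \<in> ?P" "norm_form D z = norm_form D z'" for z z'
      using cone_pairs_separated[OF D0 that] .
  qed (use B dvd_B in auto)
  finally have "real K \<le> real (sigma B) / real B"
    by (rule power2_le_imp_le) simp
  then have "real (K * B) \<le> real (sigma B)" using B by (simp add: field_simps)
  then have "K * B \<le> sigma B" by (simp only: of_nat_le_iff)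
  moreover have "has_root_mod a b c (p ^ k)" if p: "prime p" "p dvd B" for p k
  proof -
    obtain z where z: "z \<in> ?P" "p dvd nat (norm_form D z)"
      using p fin by (auto simp: B_def prime_dvd_prod_iff)
    then have "int p dvd int (nat (norm_form D z))" by (simp only: int_dvd_int_iff)
    then have "int p dvd norm_form D z" using bounds(3)[OF z(1)] by simp
    then show ?thesis
      using prime_dvd_norm_form_imp_has_root[OF D_def m(4) z(1) p(1)] by blast
  qed
  ultimately show ?thesis using B by blast
qed

text \<open>With D = 0 a root exists modulo every number prime to \<open>2 * a\<close>. The factors
  \<open>1 + u * j\<close> are prime to \<open>u = 2 * a\<close>, and as distinct divisors of their
  product they contribute a multiple of the harmonic sum.\<close>

lemma ex_abundant_zero_discriminant:
  fixes a b c :: int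
  assumes a: "a > 0" and D: "b^2 - 4 * a * c = 0"
  shows "\<exists>B>0. (\<forall>p k. prime p \<longrightarrow> p dvd B \<longrightarrow> has_root_mod a b c (p ^ k)) \<and> K * B \<le> sigma B"
proof -
  define u where "u = nat (2 * a)"
  have u: "u > 0" "int u = 2 * a" using a by (simp_all add: u_def)
  obtain J where J: "harm J \<ge> real K * (2 * real u)" using ex_harm_ge by blast
  define B where "B = (\<Prod>j=1..J. 1 + u * j)"
  have B: "B > 0" unfolding B_def by (intro prod_pos) simp
  have inj: "inj_on (\<lambda>j. 1 + u * j) {1..J}" using u by (auto simp: inj_on_def)
  have "real K \<le> harm J / (2 * real u)" using J u(1) by (simp add: field_simps)
  also have "\<dots> = (\<Sum>j=1..J. 1 / (2 * (real u * real j)))"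
    by (simp add: harm_def sum_divide_distrib field_simps)
  also have "\<dots> \<le> (\<Sum>j=1..J. 1 / real (1 + u * j))"
  proof (rule sum_mono)
    fix j assume j: "j \<in> {1..J}"
    have "1 \<le> u * j" using u(1) j by simp
    then have "real (1 + u * j) \<le> real (2 * (u * j))" by (simp only: of_nat_le_iff)
    then show "1 / (2 * (real u * real j)) \<le> 1 / real (1 + u * j)"
      using u(1) j by (intro divide_left_mono) (auto intro!: mult_pos_pos add_pos_nonneg)
  qed
  also have "\<dots> = (\<Sum>d\<in>(\<lambda>j. 1 + u * j) ` {1..J}. 1 / real d)"
    by (simp only: sum.reindex[OF inj] o_def)
  also have "\<dots> \<le> (\<Sum>d | d dvd B. 1 / real d)"
  proof (rule sum_mono2)
    show "(\<lambda>j. 1 + u * j) ` {1..J} \<subseteq> {d. d dvd B}"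
      unfolding B_def by (auto intro: dvd_prodI)
  qed (use B in auto)
  also have "\<dots> = real (sigma B) / real B" using B by (rule sum_inverse_divisors)
  finally have "real (K * B) \<le> real (sigma B)" using B by (simp add: field_simps)
  then have "K * B \<le> sigma B" by (simp only: of_nat_le_iff)
  moreover have "has_root_mod a b c (p ^ k)" if p: "prime p" "p dvd B" for p k
  proof -
    obtain j where j: "p dvd 1 + u * j"
      using p by (auto simp: B_def prime_dvd_prod_iff)
    have "coprime p u"
    proof (rule coprimeI)
      fix g assume g: "g dvd p" "g dvd u"
      then have "g dvd 1 + u * j" "g dvd u * j" using j by (auto intro: dvd_trans)
      then show "is_unit g" using dvd_add_left_iff by blast
    qed
    then have "coprime (int (p ^ k)) (2 * a)" unfolding u(2)[symmetric] by simp
    then show ?thesis using D by (intro has_root_mod_if_square[where x = 0]) simp_all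
  qed
  ultimately show ?thesis using B by blast
qed

lemma ex_abundant:
  fixes a b c :: int
  assumes "a > 0"
  shows "\<exists>B>0. (\<forall>p k. prime p \<longrightarrow> p dvd B \<longrightarrow> has_root_mod a b c (p ^ k)) \<and> K * B \<le> sigma B"
  using ex_abundant_nonzero_discriminant ex_abundant_zero_discriminant assms by blast

subsection \<open>Practical values of quadratic polynomials\<close>

lemma prime_nthprime: "prime (nthprime i)"
  using enumerate_in_set[OF primes_infinite] by (simp add: nthprime_def)

lemma ex_nthprime:
  assumes "prime p"
  shows "\<exists>i\<ge>1. nthprime i = p"
proof -
  obtain n where "enumerate {p. prime p} n = p"
    using enumerate_Ex[OF primes_infinite] assms by blast
  then show ?thesis by (intro exI[of _ "Suc n"]) (simp add: nthprime_def)
qed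

lemma nthprime_less_iff:
  assumes "i \<ge> 1" "j \<ge> 1"
  shows "nthprime i < nthprime j \<longleftrightarrow> i < j"
  using assms enumerate_mono_iff[OF primes_infinite, of "i - 1" "j - 1"]
  by (auto simp: nthprime_def)

lemma nat_dvd_if_prime_powers:
  fixes d N :: nat
  assumes "d > 0" "N > 0" "\<And>p k. prime p \<Longrightarrow> p ^ k dvd d \<Longrightarrow> p ^ k dvd N"
  shows "d dvd N"
proof (rule multiplicity_le_imp_dvd)
  fix p :: nat assume p: "prime p"
  then show "multiplicity p d \<le> multiplicity p N"
    using assms by (intro multiplicity_geI) (auto simp: multiplicity_dvd)
qed (use assms in auto)

text \<open>Positivity comes from n (n - |b|) \<ge> n > |c|; the upper bound inserts n \<le> 2
  M.\<close>

lemma quadratic_bounds: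
  fixes a b c n M :: int
  assumes a: "a > 0" and n: "n > \<bar>b\<bar> + \<bar>c\<bar>" "n \<le> 2 * M" "1 \<le> M"
  shows "0 < a * n^2 + b * n + c" "a * n^2 + b * n + c \<le> (4 * a + 2 * \<bar>b\<bar> + \<bar>c\<bar>) * M * M"
proof -
  have n0: "n > 0" using n(1) by linarith
  have bn: "\<bar>b * n\<bar> = \<bar>b\<bar> * n" using n0 by (simp add: abs_mult)
  have "n * 1 \<le> n * (n - \<bar>b\<bar>)" using n(1) n0 by (intro mult_left_mono) auto
  then have "n \<le> n^2 - \<bar>b\<bar> * n" by (simp add: power2_eq_square algebra_simps)
  moreover have "1 * n^2 \<le> a * n^2" using a by (intro mult_right_mono) auto
  ultimately show "0 < a * n^2 + b * n + c" using bn n(1) by linarith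
  have "n^2 \<le> (2 * M)^2" using n0 n(2) by (intro power_mono) auto
  then have "a * n^2 \<le> a * (2 * M)^2" using a by (intro mult_left_mono) auto
  then have 1: "a * n^2 \<le> 4 * (a * (M * M))" by (simp add: power2_eq_square)
  have MM: "M * 1 \<le> M * M" using n(3) by (intro mult_left_mono) auto
  have MM': "1 \<le> M * M" using MM n(3) by linarith
  have "\<bar>b\<bar> * n \<le> \<bar>b\<bar> * (2 * (M * M))" using n(2) MM by (intro mult_left_mono) auto
  moreover have "\<bar>c\<bar> * 1 \<le> \<bar>c\<bar> * (M * M)" using MM' by (intro mult_left_mono) auto
  ultimately have "a * n^2 + b * n + c \<le> 4 * (a * (M * M)) + \<bar>b\<bar> * (2 * (M * M)) + \<bar>c\<bar> * (M * M)"
    using 1 bn by linarith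
  also have "\<dots> = (4 * a + 2 * \<bar>b\<bar> + \<bar>c\<bar>) * M * M" by (simp add: algebra_simps)
  finally show "a * n^2 + b * n + c \<le> (4 * a + 2 * \<bar>b\<bar> + \<bar>c\<bar>) * M * M" .
qed

text \<open>Assuming finitely many values, a value beyond all of them is built as a practical
  modulus \<open>M\<close> times a cofactor of size at most \<open>sigma M\<close>.\<close>

lemma infinitely_many_practical_values:
  fixes a b c :: int
  assumes a: "a > 0" and q: "prime q" "\<And>k. has_root_mod a b c (q ^ k)"
    and P: "practical (P * q)"
    and P_root: "\<And>p k. prime p \<Longrightarrow> p ^ k dvd P \<Longrightarrow> has_root_mod a b c (p ^ k)"
  shows "infinite {x::int. \<exists>n::nat. x = a * (int n)^2 + b * int n + c \<and> x > 0 \<and> practical (nat x)}"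
    (is "infinite ?S")
proof
  assume "finite ?S"
  \<comment> \<open>If \<open>?S\<close> is empty this is an unspecified integer; only the bound on
    members is used.\<close>
  define u where "u = Max ?S"
  have u: "x \<le> u" if "x \<in> ?S" for x
    unfolding u_def using \<open>finite ?S\<close> that by (rule Max_ge)
  define K where "K = nat (4 * a + 2 * \<bar>b\<bar> + \<bar>c\<bar>)"
  have K: "int K = 4 * a + 2 * \<bar>b\<bar> + \<bar>c\<bar>" using a by (simp add: K_def)
  obtain B where B: "B > 0" "K * B \<le> sigma B"
    and B_root: "\<And>p k. prime p \<Longrightarrow> p dvd B \<Longrightarrow> has_root_mod a b c (p ^ k)"
    using ex_abundant[OF a] by blast
  \<comment> \<open>The summands serve in turn to let \<open>B\<close> be multiplied in, to push the
    new value beyond \<open>u\<close>, and to meet the threshold of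
    \<open>quadratic_bounds\<close>.\<close>
  define k where "k = B + nat \<bar>u\<bar> + nat (\<bar>b\<bar> + \<bar>c\<bar>)"
  define M where "M = P * q * q ^ k * B"
  have Pq: "P * q > 0" using P by (simp add: practical_def)
  have M0: "M > 0" using Pq B(1) by (simp add: M_def)
  have "k < 2 ^ k" by (rule less_exp)
  also have "2 ^ k \<le> q ^ k" using prime_ge_2_nat[OF q(1)] by (rule power_mono) simp
  also have "q ^ k \<le> P * q * q ^ k" using Pq by simp
  finally have k: "k < P * q * q ^ k" .
  also have "\<dots> \<le> M" using B(1) by (simp add: M_def)
  finally have kM: "k < M" .
  \<comment> \<open>Further powers of \<open>q\<close> introduce no new prime.\<close>
  have "practical (P * q * q ^ k)"
  proof (rule practical_mult[OF P])
    show "q ^ k > 0" using q(1) by (simp add: prime_gt_0_nat)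
    show "p dvd P * q \<or> p \<le> 1 + sigma (P * q)" if "prime p" "p dvd q ^ k" for p
      using prime_dvd_power[OF that] by simp
  qed
  moreover have "B \<le> 1 + sigma (P * q * q ^ k)"
    using k le_sigma[of "P * q * q ^ k"] k_def by linarith
  ultimately have M_practical: "practical M"
    unfolding M_def using B(1) by (simp add: practical_mult_le)
  have "real K \<le> real (sigma B) / real B"
    using B by (simp add: field_simps flip: of_nat_mult)
  also have "\<dots> \<le> real (sigma M) / real M"
    using M0 B(1) by (intro sigma_div_mono) (simp_all add: M_def)
  finally have "real (K * M) \<le> real (sigma M)" using M0 by (simp add: field_simps)
  then have KM: "K * M \<le> sigma M" by (simp only: of_nat_le_iff)
  \<comment> \<open>Primes of \<open>B\<close> and \<open>q\<close> admit roots modulo all their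
    powers; any other prime power dividing \<open>M\<close> divides \<open>P\<close>.\<close>
  have "has_root_mod a b c M"
  proof (rule has_root_mod_if_prime_powers[OF M0])
    fix p j assume p: "prime p" "p ^ j dvd M"
    show "has_root_mod a b c (p ^ j)"
    proof (cases "p dvd B \<or> p = q")
      case True
      then show ?thesis using B_root[OF p(1)] q(2) by blast
    next
      case False
      then have "coprime p B" "coprime p q" using p(1) q(1) by (auto intro: prime_imp_coprime primes_coprime)
      then have "p ^ j dvd P" using p(2) by (simp add: M_def coprime_dvd_mult_left_iff)
      then show ?thesis using P_root p(1) by blast
    qed
  qed
  then obtain n0 where n0: "int M dvd a * n0^2 + b * n0 + c" by (auto simp: has_root_mod_def)
  \<comment> \<open>The representative of the root in the interval from M to 2 M - 1: large enough
    for positivity, small enough to bound the cofactor.\<close>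
  define n where "n = int M + n0 mod int M"
  define x where "x = a * n^2 + b * n + c"
  have "0 \<le> n0 mod int M" "n0 mod int M < int M" using M0 by simp_all
  then have n: "int M \<le> n" "n \<le> 2 * int M" unfolding n_def by linarith+
  have "[n = n0] (mod int M)" by (simp add: n_def cong_def)
  then have M_x: "int M dvd x" unfolding x_def using n0 by (rule quadratic_dvd_cong)
  have "n > \<bar>b\<bar> + \<bar>c\<bar>" using n(1) kM by (simp add: k_def)
  then have x: "x > 0" "x \<le> int K * int M * int M"
    using quadratic_bounds[OF a _ n(2)] M0 by (simp_all add: x_def K)
  obtain t where t: "x = int M * t" using M_x by blast
  have t0: "t > 0" using x(1) t M0 by (simp add: zero_less_mult_iff)
  have "int M * t \<le> int M * (int K * int M)" using x(2) t by (simp add: ac_simps)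
  then have "t \<le> int (K * M)" using M0 by simp
  then have "nat t \<le> 1 + sigma M" using KM by linarith
  then have "practical (M * nat t)" using M_practical t0 by (intro practical_mult_le) auto
  moreover have "nat x = M * nat t" using t t0 by (simp add: nat_mult_distrib)
  ultimately have "practical (nat x)" by simp
  moreover have "x = a * (int (nat n))^2 + b * int (nat n) + c" using n(1) by (simp add: x_def)
  ultimately have "x \<in> ?S" using x(1) by blast
  then have "x \<le> u" by (rule u)
  moreover have "int M \<le> x" using M_x x(1) by (rule zdvd_imp_le)
  ultimately show False using kM by (simp add: k_def)
qed

theorem theorem2p5:
  fixes a b c :: int
  assumes "a > 0"
  shows "(\<exists>r\<ge>1. mq a b c (nthprime r) = \<infinity>) \<and>
    (let r = (LEAST r. r \<ge> 1 \<and> mq a b c (nthprime r) = \<infinity>) in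
      infinite {x::int. \<exists>n::nat. x = a * (int n)^2 + b * int n + c \<and> x > 0 \<and> practical (nat x)}
      \<longleftrightarrow> practical ((\<Prod>i\<in>{1..<r}. nthprime i ^ the_enat (mq a b c (nthprime i))) * nthprime r))"
proof -
  obtain B where B: "B > 0" "2 * B \<le> sigma B"
    and B_root: "\<And>p k. prime p \<Longrightarrow> p dvd B \<Longrightarrow> has_root_mod a b c (p ^ k)"
    using ex_abundant[OF assms] by blast
  \<comment> \<open>The case \<open>K = 2\<close> already gives existence of \<open>r\<close>: since
    \<open>sigma 1 = 1\<close>, \<open>B\<close> has a prime factor.\<close>
  have "B \<noteq> 1" using B(2) by (auto simp: sigma_def)
  then obtain p where "prime p" "p dvd B" using prime_factor_nat by blast
  then have "mq a b c p = \<infinity>" using B_root by (simp add: mq_eq_infinity_iff)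
  then have ex: "\<exists>r\<ge>1. mq a b c (nthprime r) = \<infinity>" using ex_nthprime[OF \<open>prime p\<close>] by blast
  define r where "r = (LEAST r. r \<ge> 1 \<and> mq a b c (nthprime r) = \<infinity>)"
  define P where "P = (\<Prod>i\<in>{1..<r}. nthprime i ^ the_enat (mq a b c (nthprime i)))"
  define q where "q = nthprime r"
  have r: "r \<ge> 1" "mq a b c q = \<infinity>" using LeastI_ex[OF ex] by (auto simp: r_def q_def)
  have q: "prime q" by (simp add: q_def prime_nthprime)
  \<comment> \<open>Minimality of \<open>r\<close> makes these exponents finite, so
    \<open>the_enat\<close> never meets infinity in \<open>P\<close>.\<close>
  have mq_enat: "mq a b c (nthprime i) = enat (the_enat (mq a b c (nthprime i)))"
    if "i \<in> {1..<r}" for i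
    using that not_less_Least[of i "\<lambda>r. r \<ge> 1 \<and> mq a b c (nthprime r) = \<infinity>"]
    by (cases "mq a b c (nthprime i)") (auto simp: r_def)
  have P0: "P > 0" unfolding P_def by (intro prod_pos) (simp add: prime_nthprime prime_gt_0_nat)
  have index: "\<exists>i\<in>{1..<r}. nthprime i = p" if "prime p" "p < q" for p
    using ex_nthprime[OF that(1)] that(2) nthprime_less_iff r(1) by (auto simp: q_def)
  \<comment> \<open>This and \<open>P_root\<close> characterise \<open>P\<close>: below
    \<open>q\<close>, the prime powers dividing \<open>P\<close> are exactly those with a
    root.\<close>
  have dvd_P: "p ^ k dvd P" if p: "prime p" "p < q" and root: "has_root_mod a b c (p ^ k)" for p k
  proof -
    obtain i where i: "i \<in> {1..<r}" "nthprime i = p" using index[OF p] by blast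
    have "enat k \<le> mq a b c p" using root by (simp add: enat_le_mq_iff)
    then have "k \<le> the_enat (mq a b c p)" using mq_enat[OF i(1)] i(2) by (metis enat_ord_simps(1))
    then have "p ^ k dvd p ^ the_enat (mq a b c p)" by (rule le_imp_power_dvd)
    also have "\<dots> dvd P" unfolding P_def using i by (auto intro: dvd_prodI)
    finally show ?thesis .
  qed
  have P_less: "p < q" if p: "prime p" "p dvd P" for p
  proof -
    obtain i where i: "i \<in> {1..<r}" "p dvd nthprime i"
      using p by (auto simp: P_def prime_dvd_prod_iff dest: prime_dvd_power)
    then have "p = nthprime i" using p(1) prime_nthprime primes_dvd_imp_eq by blast
    then show ?thesis using i(1) nthprime_less_iff[of i r] r(1) by (simp add: q_def)
  qed
  have P_root: "has_root_mod a b c (p ^ k)" if p: "prime p" "p ^ k dvd P" for p k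
  proof (cases "k = 0")
    case True
    then show ?thesis by (simp add: has_root_mod_def)
  next
    case False
    then have "p dvd P" using p(2) by (meson dvd_power dvd_trans gr0I)
    then have "p < q" using P_less p(1) by blast
    then obtain i where i: "i \<in> {1..<r}" "nthprime i = p" using index p(1) by blast
    define m where "m = the_enat (mq a b c p)"
    have m: "mq a b c p = enat m" using mq_enat[OF i(1)] i(2) by (simp add: m_def)
    define R where "R = (\<Prod>j\<in>{1..<r} - {i}. nthprime j ^ the_enat (mq a b c (nthprime j)))"
    have "coprime (p ^ k) R" unfolding R_def
    proof (rule prod_coprime_right)
      fix j assume j: "j \<in> {1..<r} - {i}"
      then have "p \<noteq> nthprime j"
        using i nthprime_less_iff[of i j] nthprime_less_iff[of j i] by force
      then have "coprime p (nthprime j)" using p(1) prime_nthprime by (intro primes_coprime)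
      then show "coprime (p ^ k) (nthprime j ^ the_enat (mq a b c (nthprime j)))" by simp
    qed
    moreover have "P = p ^ m * R"
      unfolding P_def R_def m_def i(2)[symmetric] by (rule prod.remove) (use i(1) in auto)
    ultimately have "p ^ k dvd p ^ m" using p(2) coprime_dvd_mult_left_iff by blast
    moreover have "has_root_mod a b c (p ^ m)" using m enat_le_mq_iff by (metis order_refl)
    ultimately show ?thesis by (rule has_root_mod_dvd[rotated])
  qed
  let ?S = "{x::int. \<exists>n::nat. x = a * (int n)^2 + b * int n + c \<and> x > 0 \<and> practical (nat x)}"
  have "infinite ?S \<longleftrightarrow> practical (P * q)"
  proof
    assume "infinite ?S"
    \<comment> \<open>One practical value above \<open>q\<close> suffices: its representations reach
      \<open>p - 1\<close> for every prime \<open>p\<close> of \<open>P * q\<close>.\<close>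
    then have "\<not> ?S \<subseteq> {0..int q}" by (rule contrapos_nn) (rule finite_subset, assumption, simp)
    then obtain x where "x \<in> ?S" "x \<notin> {0..int q}" by blast
    then obtain n :: nat where x: "x = a * (int n)^2 + b * int n + c" "practical (nat x)" "x > int q"
      by (simp only: mem_Collect_eq atLeastAtMost_iff) (use less_imp_le not_le in blast)
    define N where "N = nat x"
    have N: "practical N" "q \<le> N" "N > 0" and N_root: "has_root_mod a b c N"
      using x by (auto simp: N_def has_root_mod_def intro: exI[of _ "int n"])
    have "stewart (P * q)" unfolding stewart_def
    proof (intro conjI allI impI)
      show "P * q > 0" using P0 q by (simp add: prime_gt_0_nat)
      fix p assume p: "prime p" "p dvd P * q"
      have pq: "p \<le> q"
      proof (cases "p dvd P")
        case True
        then show ?thesis using P_less p(1) by (simp add: less_imp_le)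
      next
        case False
        then have "p dvd q" using p prime_dvd_mult_iff by blast
        then show ?thesis using primes_dvd_imp_eq[OF p(1) q] by simp
      qed
      \<comment> \<open>Prime powers dividing the value \<open>N\<close> have roots, and those of
        primes below \<open>p \<le> q\<close> therefore divide \<open>P\<close>.\<close>
      have "smooth_divisors N p \<subseteq> smooth_divisors (P * q) p"
      proof
        fix d assume d: "d \<in> smooth_divisors N p"
        have "d dvd P"
        proof (rule nat_dvd_if_prime_powers[OF _ P0])
          show "d > 0" using d N(3) by (auto simp: smooth_divisors_def intro: dvd_pos_nat)
          fix s k assume s: "prime s" "s ^ k dvd d"
          show "s ^ k dvd P"
          proof (cases "k = 0")
            case False
            then have "s dvd d" using s(2) by (meson dvd_power dvd_trans gr0I)
            then have "s < q" using d s(1) pq by (auto simp: smooth_divisors_def)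
            moreover have "s ^ k dvd N" using s(2) d by (auto simp: smooth_divisors_def intro: dvd_trans)
            then have "has_root_mod a b c (s ^ k)" by (rule has_root_mod_dvd[OF N_root])
            ultimately show ?thesis using dvd_P[OF s(1)] by simp
          qed simp
        qed
        then show "d \<in> smooth_divisors (P * q) p" using d by (auto simp: smooth_divisors_def)
      qed
      then have "\<Sum>(smooth_divisors N p) \<le> \<Sum>(smooth_divisors (P * q) p)"
        using P0 q by (intro sum_nat_mono_subset finite_smooth_divisors) (simp_all add: prime_gt_0_nat)
      moreover have "p \<le> 1 + \<Sum>(smooth_divisors N p)"
        using N(1,2) pq prime_gt_1_nat[OF p(1)] by (intro practical_imp_le_smooth_divisors) auto
      ultimately show "p \<le> 1 + \<Sum>(smooth_divisors (P * q) p)" by linarith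
    qed
    then show "practical (P * q)" by (simp add: practical_iff_stewart)
  next
    assume "practical (P * q)"
    moreover have "has_root_mod a b c (q ^ k)" for k using r(2) by (simp add: mq_eq_infinity_iff)
    ultimately show "infinite ?S"
      using P_root by (intro infinitely_many_practical_values[OF assms q]) auto
  qed
  then show ?thesis using ex by (simp only: Let_def r_def[symmetric] P_def[symmetric] q_def[symmetric])
qed

end
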